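(* Let $N\ge1$ be an integer, let $B,R>0$, let $X\subseteq\mathbb{R}^n$ be a nonempty closed convex set, and let $f$ be a convex function whose domain contains $X$, with $\partial f(x)\ne\emptyset$ for every $x\in X$ and with $B$-bounded subgradients on $X$. Let $x^*$ be a minimizer of $f$ over $X$, let $f^\star=f(x^* )$, and let $x^1\in X$ satisfy $\|x^1-x^*\|\le R$. Let $h>0$ and let $x^2,\dots,x^{N+1}$ be generated by $$x^{k+1}=P_X\left(x^k-h\tfrac{R}{B}g^k\right),\qquad g^k\in\partial f(x^k),\qquad k=1,\dots,N.$$ Then $$f(x^{N+1})-f^\star\le\begin{cases}BR\,(1-Nh)&\text{if } h\le \frac{1}{s_{N+1}^2},\\[2mm] BR\left(\left(\tfrac12 s_{N+1}^2-N\right)h+\frac{1}{2s_{N+1}^2h}\right)&\text{if } h>\frac{1}{s_{N+1}^2}.\end{cases}$$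
   Context: $\|\cdot\|$ is the Euclidean norm and $P_X$ is the Euclidean projection onto $X$. The subdifferential is $\partial f(x)=\{g\in\mathbb{R}^n : f(y)\ge f(x)+\langle g,y-x\rangle \text{ for all } y\in\mathrm{dom} f\}$. The function $f$ has $B$-bounded subgradients on $X$ if $\|g\|\le B$ for all $x\in X$ and $g\in\partial f(x)$. The real sequence $(s_k)_{k\ge1}$ is defined by $s_1=1$ and $s_{k+1}=s_k+\frac{1}{s_k}$. *)

theory Defs
  imports "HOL-Analysis.Analysis"
begin

text \<open>
  A convex function with domain \<open>D\<close> is represented by the set \<open>D\<close> together with a total
  function \<open>f\<close> satisfying \<^term>\<open>convex_on D f\<close>; values of \<open>f\<close> outside \<open>D\<close> play no role.
\<close>

definition subdifferential ::
  "(real ^ 'n) set \<Rightarrow> (real ^ 'n \<Rightarrow> real) \<Rightarrow> real ^ 'n \<Rightarrow> (real ^ 'n) set" where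
  "subdifferential D f x = {g. \<forall>y\<in>D. f y \<ge> f x + g \<bullet> (y - x)}"

definition bounded_subgradients ::
  "real \<Rightarrow> (real ^ 'n) set \<Rightarrow> (real ^ 'n) set \<Rightarrow> (real ^ 'n \<Rightarrow> real) \<Rightarrow> bool" where
  "bounded_subgradients B X D f \<longleftrightarrow> (\<forall>x\<in>X. \<forall>g\<in>subdifferential D f x. norm g \<le> B)"

text \<open>The sequence is indexed from 1; the value at 0 is a dummy.\<close>

fun s :: "nat \<Rightarrow> real" where
  "s 0 = 0"
| "s (Suc 0) = 1"
| "s (Suc (Suc k)) = s (Suc k) + 1 / s (Suc k)"

end

theory Submission
  imports Defs
begin

text \<open>
  Instead of comparing the iterates with \<open>x\<^sup>*\<close> only, compare \<open>x\<^sup>n\<^sup>+\<^sup>1\<close> with a moving reference point \<open>z\<^sub>n\<close>,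
  a convex combination of \<open>x\<^sup>*, x\<^sup>1, \<dots>, x\<^sup>n\<close>. If \<open>t\<^sub>0, \<dots>, t\<^sub>N\<close> are positive with
  \<open>t\<^sub>n = t\<^sub>n\<^sub>+\<^sub>1 + 1/t\<^sub>n\<^sub>+\<^sub>1\<close> and \<open>H\<close> is the step length, then averaging \<open>x\<^sup>n\<close> and \<open>z\<^sub>n\<^sub>-\<^sub>1\<close> with weights
  \<open>1 - t\<^sub>n/t\<^sub>n\<^sub>-\<^sub>1\<close> and \<open>t\<^sub>n/t\<^sub>n\<^sub>-\<^sub>1\<close> makes the values \<open>f(x\<^sup>n)\<close> cancel, so that
  \<open>\<parallel>x\<^sup>n\<^sup>+\<^sup>1 - z\<^sub>n\<parallel>\<^sup>2/t\<^sub>n\<^sup>2 + 2H(f(z\<^sub>n) - f\<^sup>\<star>)\<close> grows by at most \<open>H\<^sup>2B\<^sup>2/t\<^sub>n\<^sup>2\<close> in step \<open>n\<close>.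
  The subgradient inequality at \<open>x\<^sup>N\<^sup>+\<^sup>1\<close> passes from \<open>f(z\<^sub>N)\<close> to \<open>f(x\<^sup>N\<^sup>+\<^sup>1)\<close>, and the resulting bound depends
  on \<open>t\<close> only through \<open>t\<^sub>0\<close>. Going backwards, every \<open>t\<^sub>0 \<ge> s\<^sub>N\<^sub>+\<^sub>1\<close> is admissible; the best choices are
  \<open>t\<^sub>0\<^sup>2 = 1/h\<close> if \<open>h \<le> 1/s\<^sub>N\<^sub>+\<^sub>1\<^sup>2\<close>, and \<open>t\<^sub>0 = s\<^sub>N\<^sub>+\<^sub>1\<close> otherwise.
\<close>

lemma s_ge_1: "1 \<le> s (Suc n)"
  by (induction n) (auto intro: order_trans)

text \<open>By the intermediate value theorem on \<open>{l..y}\<close>: t + 1/t is at most y at the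
  left end by assumption, and at least y at t = y.\<close>

lemma add_inverse_solution:
  fixes y l :: real
  assumes "0 < l" "l + 1 / l \<le> y"
  obtains t where "l \<le> t" "y = t + 1 / t"
proof -
  have "l \<le> y"
    using assms by (smt (verit) divide_pos_pos)
  moreover have "y \<le> y + 1 / y"
    using assms(1) \<open>l \<le> y\<close> by simp
  moreover have "continuous_on {l..y} (\<lambda>t. t + 1 / t)"
    using assms(1) by (intro continuous_intros) auto
  ultimately obtain t where "l \<le> t" "t + 1 / t = y"
    using IVT'[of "\<lambda>t. t + 1 / t" l y y] assms(2) by blast
  then show ?thesis
    using that by simp
qed

text \<open>Since \<open>s\<close> obeys the same recurrence, a start above
  \<open>s (Suc (Suc N))\<close> has a successor u above \<open>s (Suc N)\<close>. By induction an
  orbit of length N starts at u, and y is put in front of it.\<close>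

lemma backward_orbit_exists:
  assumes "s (Suc N) \<le> y"
  shows "\<exists>t. t 0 = y \<and> (\<forall>n\<le>N. 0 < t n) \<and> (\<forall>n<N. t n = t (Suc n) + 1 / t (Suc n))"
  using assms
proof (induction N arbitrary: y)
  case 0
  then show ?case
    by (intro exI[of _ "\<lambda>_. y"]) auto
next
  case (Suc N)
  have spos: "0 < s (Suc N)"
    using s_ge_1[of N] by simp
  obtain u where u: "s (Suc N) \<le> u" "y = u + 1 / u"
    using add_inverse_solution[of "s (Suc N)" y] spos Suc.prems by auto
  obtain t where t: "t 0 = u" "\<forall>n\<le>N. 0 < t n" "\<forall>n<N. t n = t (Suc n) + 1 / t (Suc n)"
    using Suc.IH[OF u(1)] by blast
  have "0 < y"
    using spos u by (simp add: add_pos_pos)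
  then show ?case
    using t u(2)
    by (intro exI[of _ "case_nat y t"]) (auto split: nat.split)
qed

text \<open>The projection is nonexpansive and fixes z. Expanding the square leaves an inner product
  that the subgradient inequality controls.\<close>

lemma projected_subgradient_step:
  fixes X D :: "(real ^ 'n) set"
  assumes X: "closed X" "convex X" "X \<subseteq> D" and z: "z \<in> X" and "0 \<le> H"
    and g: "g \<in> subdifferential D f x" "norm g \<le> B"
  shows "(norm (closest_point X (x - H *\<^sub>R g) - z))\<^sup>2
    \<le> (norm (x - z))\<^sup>2 - 2 * H * (f x - f z) + H\<^sup>2 * B\<^sup>2"
proof -
  have "norm (closest_point X (x - H *\<^sub>R g) - z) \<le> norm (x - H *\<^sub>R g - z)"
    using closest_point_lipschitz[of X "x - H *\<^sub>R g" z] X z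
    by (auto simp: dist_norm closest_point_self)
  then have "(norm (closest_point X (x - H *\<^sub>R g) - z))\<^sup>2 \<le> (norm (x - H *\<^sub>R g - z))\<^sup>2"
    by (intro power_mono) auto
  also have "\<dots> = (norm (x - z))\<^sup>2 + 2 * H * (g \<bullet> (z - x)) + H\<^sup>2 * (norm g)\<^sup>2"
    by (simp only: power2_norm_eq_inner) (simp add: inner_simps inner_commute algebra_simps power2_eq_square)
  also have "\<dots> \<le> (norm (x - z))\<^sup>2 + 2 * H * (f z - f x) + H\<^sup>2 * B\<^sup>2"
  proof -
    have "g \<bullet> (z - x) \<le> f z - f x"
      using g(1) z X(3) unfolding subdifferential_def by (fastforce simp: algebra_simps)
    then have "2 * H * (g \<bullet> (z - x)) \<le> 2 * H * (f z - f x)"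
      using \<open>0 \<le> H\<close> by (intro mult_left_mono) auto
    moreover have "H\<^sup>2 * (norm g)\<^sup>2 \<le> H\<^sup>2 * B\<^sup>2"
      using g(2) by (intro mult_left_mono power_mono) auto
    ultimately show ?thesis
      by linarith
  qed
  finally show ?thesis
    by (simp add: algebra_simps)
qed

text \<open>One step of the potential, with \<tau> as the new weight and \<tau> + 1/\<tau> as the
  old one; w replaces the reference point z.\<close>

lemma averaged_reference_step:
  fixes X D :: "(real ^ 'n) set"
  assumes X: "closed X" "convex X" "X \<subseteq> D" and f: "convex_on D f"
    and x: "x \<in> X" and z: "z \<in> X" and H: "0 \<le> H" and \<tau>: "0 < \<tau>"
    and g: "g \<in> subdifferential D f x" "norm g \<le> B"
  shows "\<exists>w\<in>X. (norm (closest_point X (x - H *\<^sub>R g) - w))\<^sup>2 / \<tau>\<^sup>2 + 2 * H * f w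
    \<le> (norm (x - z))\<^sup>2 / (\<tau> + 1 / \<tau>)\<^sup>2 + 2 * H * f z + H\<^sup>2 * B\<^sup>2 / \<tau>\<^sup>2"
proof -
  \<comment> \<open>This ratio of new to old weight does two things: x - w = \<mu>(x - z) converts
    the weight of the squared distance, and f x gets the coefficient 1/\<tau>^2 once convexity is
    scaled by 1 + 1/\<tau>^2.\<close>
  define \<mu> where "\<mu> = \<tau> / (\<tau> + 1 / \<tau>)"
  define w where "w = (1 - \<mu>) *\<^sub>R x + \<mu> *\<^sub>R z"
  have pos: "0 < \<tau> + 1 / \<tau>"
    using \<tau> by (simp add: add_pos_pos)
  have \<mu>: "0 \<le> \<mu>" "\<mu> \<le> 1"
    using \<tau> pos by (simp_all add: \<mu>_def)
  have \<mu>_mult: "\<mu> * (1 + 1 / \<tau>\<^sup>2) = 1" and \<mu>_compl: "(1 - \<mu>) * (1 + 1 / \<tau>\<^sup>2) = 1 / \<tau>\<^sup>2"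
  proof -
    have "\<tau> + 1 / \<tau> = \<tau> * (1 + 1 / \<tau>\<^sup>2)"
      using \<tau> by (simp add: field_simps power2_eq_square)
    moreover have "0 < 1 + 1 / \<tau>\<^sup>2"
      using \<tau> by (simp add: add_pos_pos)
    ultimately show "\<mu> * (1 + 1 / \<tau>\<^sup>2) = 1"
      using \<tau> by (simp add: \<mu>_def)
    then show "(1 - \<mu>) * (1 + 1 / \<tau>\<^sup>2) = 1 / \<tau>\<^sup>2"
      by (simp add: left_diff_distrib)
  qed
  have "w \<in> X"
    using X(2) x z \<mu> unfolding w_def by (intro convexD) auto
  have "x - w = \<mu> *\<^sub>R (x - z)"
    by (simp add: w_def algebra_simps)
  then have dist: "(norm (x - w))\<^sup>2 / \<tau>\<^sup>2 = (norm (x - z))\<^sup>2 / (\<tau> + 1 / \<tau>)\<^sup>2"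
    using \<tau> by (simp add: \<mu>_def power_mult_distrib power_divide)
  have "f w \<le> (1 - \<mu>) * f x + \<mu> * f z"
    using convex_onD[OF f, of \<mu> x z] \<mu> x z X(3) by (auto simp: w_def)
  then have "f w * (1 + 1 / \<tau>\<^sup>2) \<le> ((1 - \<mu>) * f x + \<mu> * f z) * (1 + 1 / \<tau>\<^sup>2)"
    by (intro mult_right_mono) auto
  also have "\<dots> = f x * ((1 - \<mu>) * (1 + 1 / \<tau>\<^sup>2)) + f z * (\<mu> * (1 + 1 / \<tau>\<^sup>2))"
    by (simp add: algebra_simps add_divide_distrib diff_divide_distrib)
  also have "\<dots> = f x / \<tau>\<^sup>2 + f z"
    unfolding \<mu>_mult \<mu>_compl by simp
  finally have "f w - (f x - f w) / \<tau>\<^sup>2 \<le> f z"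
    by (simp add: algebra_simps diff_divide_distrib)
  then have fw: "2 * H * (f w - (f x - f w) / \<tau>\<^sup>2) \<le> 2 * H * f z"
    using H by (intro mult_left_mono) auto
  have "(norm (closest_point X (x - H *\<^sub>R g) - w))\<^sup>2 / \<tau>\<^sup>2
      \<le> ((norm (x - w))\<^sup>2 - 2 * H * (f x - f w) + H\<^sup>2 * B\<^sup>2) / \<tau>\<^sup>2"
    using projected_subgradient_step[OF X \<open>w \<in> X\<close> H g] by (intro divide_right_mono) auto
  also have "\<dots> = (norm (x - z))\<^sup>2 / (\<tau> + 1 / \<tau>)\<^sup>2 - 2 * H * ((f x - f w) / \<tau>\<^sup>2) + H\<^sup>2 * B\<^sup>2 / \<tau>\<^sup>2"
    unfolding dist[symmetric] by (simp add: algebra_simps add_divide_distrib diff_divide_distrib)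
  finally have "(norm (closest_point X (x - H *\<^sub>R g) - w))\<^sup>2 / \<tau>\<^sup>2 + 2 * H * f w
    \<le> (norm (x - z))\<^sup>2 / (\<tau> + 1 / \<tau>)\<^sup>2 + 2 * H * f z + H\<^sup>2 * B\<^sup>2 / \<tau>\<^sup>2"
    using fw by (simp add: right_diff_distrib)
  then show ?thesis
    using \<open>w \<in> X\<close> by blast
qed

lemma last_iterate_bound:
  fixes X D :: "(real ^ 'n) set" and x g :: "nat \<Rightarrow> real ^ 'n" and t :: "nat \<Rightarrow> real"
  assumes X: "closed X" "convex X" "X \<subseteq> D" and f: "convex_on D f"
    and ne: "\<forall>z\<in>X. subdifferential D f z \<noteq> {}" and B: "bounded_subgradients B X D f"
    and z: "z \<in> X" and x1: "x 1 \<in> X" and H: "0 \<le> H"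
    and g: "\<forall>k\<in>{1..N}. g k \<in> subdifferential D f (x k)"
    and x: "\<forall>k\<in>{1..N}. x (k + 1) = closest_point X (x k - H *\<^sub>R g k)"
    and t_pos: "\<forall>n\<le>N. 0 < t n" and t: "\<forall>n<N. t n = t (Suc n) + 1 / t (Suc n)"
  shows "2 * H * (f (x (N + 1)) - f z)
    \<le> (norm (x 1 - z))\<^sup>2 / (t 0)\<^sup>2 + H\<^sup>2 * B\<^sup>2 * ((t 0)\<^sup>2 - 2 * real N)"
proof -
  have x_in: "x (Suc n) \<in> X" if "n \<le> N" for n
  proof (cases n)
    case 0
    then show ?thesis
      using x1 by simp
  next
    case (Suc m)
    then show ?thesis
      using that x X(1) z closest_point_in_set[of X "x n - H *\<^sub>R g n"] by auto
  qed
  have reference: "\<exists>w\<in>X. (norm (x (Suc n) - w))\<^sup>2 / (t n)\<^sup>2 + 2 * H * (f w - f z)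
      \<le> (norm (x 1 - z))\<^sup>2 / (t 0)\<^sup>2 + H\<^sup>2 * B\<^sup>2 * ((t 0)\<^sup>2 - (t n)\<^sup>2 - 2 * real n)"
    if "n \<le> N" for n
    using that
  proof (induction n)
    case 0
    then show ?case
      using z by (intro bexI[of _ z]) auto
  next
    case (Suc n)
    let ?\<tau> = "t (Suc n)"
    obtain v where v: "v \<in> X" "(norm (x (Suc n) - v))\<^sup>2 / (t n)\<^sup>2 + 2 * H * (f v - f z)
      \<le> (norm (x 1 - z))\<^sup>2 / (t 0)\<^sup>2 + H\<^sup>2 * B\<^sup>2 * ((t 0)\<^sup>2 - (t n)\<^sup>2 - 2 * real n)"
      using Suc by auto
    have \<tau>: "0 < ?\<tau>" "t n = ?\<tau> + 1 / ?\<tau>"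
      using t_pos t Suc.prems by auto
    have gn: "g (Suc n) \<in> subdifferential D f (x (Suc n))" "norm (g (Suc n)) \<le> B"
      using g Suc.prems B x_in[of n] by (auto simp: bounded_subgradients_def)
    have xn: "x (Suc (Suc n)) = closest_point X (x (Suc n) - H *\<^sub>R g (Suc n))"
      using x Suc.prems by auto
    obtain w where w: "w \<in> X" "(norm (x (Suc (Suc n)) - w))\<^sup>2 / ?\<tau>\<^sup>2 + 2 * H * f w
      \<le> (norm (x (Suc n) - v))\<^sup>2 / (t n)\<^sup>2 + 2 * H * f v + H\<^sup>2 * B\<^sup>2 / ?\<tau>\<^sup>2"
      using averaged_reference_step[OF X f x_in v(1) H \<tau>(1) gn] Suc.prems
      unfolding xn \<tau>(2) by auto
    \<comment> \<open>The squared recurrence turns the error 1/\<tau>^2 into a difference of squares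
      minus 2, so the errors telescope.\<close>
    have "(t n)\<^sup>2 = ?\<tau>\<^sup>2 + 2 + 1 / ?\<tau>\<^sup>2"
      using \<tau> by (simp add: power2_sum power_divide)
    then have "H\<^sup>2 * B\<^sup>2 * ((t 0)\<^sup>2 - (t n)\<^sup>2 - 2 * real n) + H\<^sup>2 * B\<^sup>2 / ?\<tau>\<^sup>2
        = H\<^sup>2 * B\<^sup>2 * ((t 0)\<^sup>2 - ?\<tau>\<^sup>2 - 2 * real (Suc n))"
      by (simp add: algebra_simps)
    then show ?case
      using v(2) w by (intro bexI[of _ w]) (auto simp: right_diff_distrib)
  qed
  obtain w where w: "w \<in> X" "(norm (x (Suc N) - w))\<^sup>2 / (t N)\<^sup>2 + 2 * H * (f w - f z)
      \<le> (norm (x 1 - z))\<^sup>2 / (t 0)\<^sup>2 + H\<^sup>2 * B\<^sup>2 * ((t 0)\<^sup>2 - (t N)\<^sup>2 - 2 * real N)"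
    using reference by blast
  let ?d = "norm (x (Suc N) - w)"
  obtain q where q: "q \<in> subdifferential D f (x (Suc N))"
    using ne x_in[of N] by auto
  have "norm q \<le> B"
    using B q x_in[of N] by (auto simp: bounded_subgradients_def)
  have "f (x (Suc N)) - f w \<le> q \<bullet> (x (Suc N) - w)"
    using q w(1) X(3) unfolding subdifferential_def by (fastforce simp: inner_diff_right)
  also have "\<dots> \<le> norm q * ?d"
    by (rule norm_cauchy_schwarz)
  also have "\<dots> \<le> B * ?d"
    using \<open>norm q \<le> B\<close> by (intro mult_right_mono) auto
  finally have "2 * H * (f (x (Suc N)) - f w) \<le> 2 * H * (B * ?d)"
    using H by (intro mult_left_mono) auto
  \<comment> \<open>The product is split by 2ab \<le> a^2 + b^2 so that both squares are absorbed:
    the first is in the potential, the second cancels the \<open>(t N)\<^sup>2\<close> left by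
    telescoping.\<close>
  also have "\<dots> \<le> ?d\<^sup>2 / (t N)\<^sup>2 + H\<^sup>2 * B\<^sup>2 * (t N)\<^sup>2"
  proof -
    have "0 < t N"
      using t_pos by simp
    then show ?thesis
      using sum_squares_bound[of "?d / t N" "H * B * t N"]
      by (simp add: power_divide power_mult_distrib mult_ac)
  qed
  finally show ?thesis
    using w(2) by (simp add: algebra_simps)
qed

theorem theorem3p4:
  fixes N :: nat and B R h :: real
    and X D :: "(real ^ 'n) set" and f :: "real ^ 'n \<Rightarrow> real"
    and x g :: "nat \<Rightarrow> real ^ 'n" and xs :: "real ^ 'n"
  assumes "N \<ge> 1" and "B > 0" and "R > 0"
    and "X \<noteq> {}" and "closed X" and "convex X"
    and "convex_on D f" and "X \<subseteq> D"
    and "\<forall>z\<in>X. subdifferential D f z \<noteq> {}"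
    and "bounded_subgradients B X D f"
    and "is_arg_min f (\<lambda>z. z \<in> X) xs"
    and "x 1 \<in> X" and "norm (x 1 - xs) \<le> R"
    and "h > 0"
    and "\<forall>k\<in>{1..N}. g k \<in> subdifferential D f (x k)"
    and "\<forall>k\<in>{1..N}. x (k + 1) = closest_point X (x k - (h * (R / B)) *\<^sub>R g k)"
  shows "f (x (N + 1)) - f xs \<le>
    (if h \<le> 1 / (s (N + 1))\<^sup>2
     then B * R * (1 - real N * h)
     else B * R * ((1 / 2 * (s (N + 1))\<^sup>2 - real N) * h + 1 / (2 * (s (N + 1))\<^sup>2 * h)))"
proof -
  define H where "H = h * (R / B)"
  have "0 < H"
    using assms by (simp add: H_def)
  have xs: "xs \<in> X"
    using assms(11) by (simp add: is_arg_min_def)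
  have x1: "(norm (x 1 - xs))\<^sup>2 \<le> R\<^sup>2"
    using assms(13) by (intro power_mono) auto
  have bound: "f (x (N + 1)) - f xs \<le> B * R * ((1 / 2 * y\<^sup>2 - real N) * h + 1 / (2 * y\<^sup>2 * h))"
    if y: "s (N + 1) \<le> y" for y
  proof -
    obtain t where t: "t 0 = y" "\<forall>n\<le>N. 0 < t n" "\<forall>n<N. t n = t (Suc n) + 1 / t (Suc n)"
      using backward_orbit_exists[of N y] y[unfolded Suc_eq_plus1[symmetric]] by blast
    have "y \<noteq> 0"
      using y s_ge_1[of N] by auto
    have "2 * H * (f (x (N + 1)) - f xs)
        \<le> (norm (x 1 - xs))\<^sup>2 / y\<^sup>2 + H\<^sup>2 * B\<^sup>2 * (y\<^sup>2 - 2 * real N)"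
      unfolding t(1)[symmetric] using \<open>0 < H\<close> assms(15,16) xs t(2,3)
      by (intro last_iterate_bound[of X D f B xs x H N g t] assms(5-10,12))
        (simp_all only: H_def less_imp_le)
    also have "\<dots> \<le> R\<^sup>2 / y\<^sup>2 + H\<^sup>2 * B\<^sup>2 * (y\<^sup>2 - 2 * real N)"
      using x1 by (intro add_right_mono divide_right_mono) auto
    also have "\<dots> = 2 * H * (B * R * ((1 / 2 * y\<^sup>2 - real N) * h + 1 / (2 * y\<^sup>2 * h)))"
      using \<open>y \<noteq> 0\<close> assms(2,3,14) by (simp add: H_def field_simps power2_eq_square)
    finally show ?thesis
      using \<open>0 < H\<close> by simp
  qed
  \<comment> \<open>In \<open>bound\<close>, y enters only through (u + 1/u)/2 with u = y^2 h. This
    is least at u = 1, with value 1, and increases for u \<ge> 1; if y^2 = 1/h is too small to be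
    admissible, the left endpoint is best.\<close>
  show ?thesis
  proof (cases "h \<le> 1 / (s (N + 1))\<^sup>2")
    case True
    have "0 < s (N + 1)"
      using s_ge_1[of N] by simp
    then have "(s (N + 1))\<^sup>2 \<le> 1 / h"
      using True assms(14) by (simp add: field_simps)
    then have "s (N + 1) \<le> sqrt (1 / h)"
      by (rule real_le_rsqrt)
    then show ?thesis
      using bound[of "sqrt (1 / h)"] True assms(14) by (simp add: algebra_simps)
  next
    case False
    then show ?thesis
      using bound[of "s (N + 1)"] by simp
  qed
qed

end
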